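(* Let $\{\phi_i\}_{i\in I}$ and $\{\psi_i\}_{i\in I}$ be two woven frames for $\mathcal H$, let $\sigma\subset I$, and let $\{\varphi_i\}_{i\in I}$ be an alternate dual frame of the weaving frame $\{\phi_i\}_{i\in\sigma}\cup\{\psi_i\}_{i\in\sigma^c}$. Then for all $f\in\mathcal H$, $$\Big(\sum_{i\in\sigma}\langle f,\varphi_i\rangle\overline{\langle f,\phi_i\rangle}\Big)+\Big\|\sum_{i\in\sigma^c}\langle f,\varphi_i\rangle\psi_i\Big\|^2=\overline{\Big(\sum_{i\in\sigma^c}\langle f,\varphi_i\rangle\overline{\langle f,\psi_i\rangle}\Big)}+\Big\|\sum_{i\in\sigma}\langle f,\varphi_i\rangle\phi_i\Big\|^2 .$$
   Context: $\mathcal H$ is a separable Hilbert space with inner product linear in the first argument, $I$ is a countable index set, and for $\sigma\subset I$ one writes $\sigma^c=I\setminus\sigma$. A family $\{\phi_i\}_{i\in I}$ in $\mathcal H$ is a frame with lower and upper frame bounds $A,B>0$ if $A\|f\|^2\le\sum_{i\in I}|\langle f,\phi_i\rangle|^2\le B\|f\|^2$ for all $f\in\mathcal H$. Two frames $\{\phi_i\}_{i\in I}$ and $\{\psi_i\}_{i\in I}$ for $\mathcal H$ are woven if there are universal constants $A,B>0$ such that for every $\sigma\subset I$ the family $\{\phi_i\}_{i\in\sigma}\cup\{\psi_i\}_{i\in\sigma^c}$ (called a weaving) is a frame for $\mathcal H$ with lower and upper bounds $A$ and $B$. A frame $\{\varphi_i\}_{i\in I}$ for $\mathcal H$ is an alternate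 dual frame of the weaving $\{\phi_i\}_{i\in\sigma}\cup\{\psi_i\}_{i\in\sigma^c}$ if for all $f\in\mathcal H$, $f=\sum_{i\in\sigma}\langle f,\phi_i\rangle\varphi_i+\sum_{i\in\sigma^c}\langle f,\psi_i\rangle\varphi_i$ (equivalently, $f=\sum_{i\in\sigma}\langle f,\varphi_i\rangle\phi_i+\sum_{i\in\sigma^c}\langle f,\varphi_i\rangle\psi_i$ for all $f\in\mathcal H$). *)

theory Defs
  imports "HOL-Analysis.Analysis"
begin

text \<open>
  Complex Hilbert spaces, in the style of \<^class>\<open>real_inner\<close>. The inner product is linear in its
  first argument. Since the class extends \<^class>\<open>real_normed_vector\<close>, its norm, metric and
  topology are those induced by the inner product.
\<close>

class complex_inner_space = real_normed_vector +
  fixes scaleC :: "complex \<Rightarrow> 'a \<Rightarrow> 'a" (infixr "*\<^sub>C" 75)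
    and cinner :: "'a \<Rightarrow> 'a \<Rightarrow> complex"
  assumes scaleC_add_right: "a *\<^sub>C (x + y) = a *\<^sub>C x + a *\<^sub>C y"
    and scaleC_add_left: "(a + b) *\<^sub>C x = a *\<^sub>C x + b *\<^sub>C x"
    and scaleC_scaleC: "a *\<^sub>C b *\<^sub>C x = (a * b) *\<^sub>C x"
    and scaleC_of_real: "complex_of_real r *\<^sub>C x = r *\<^sub>R x"
    and cinner_commute: "cinner x y = cnj (cinner y x)"
    and cinner_add_left: "cinner (x + y) z = cinner x z + cinner y z"
    and cinner_scaleC_left: "cinner (a *\<^sub>C x) y = a * cinner x y"
    and cinner_ge_zero: "0 \<le> Re (cinner x x)"
    and cinner_eq_zero_iff: "cinner x x = 0 \<longleftrightarrow> x = 0"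
    and norm_eq_sqrt_cinner: "norm x = sqrt (Re (cinner x x))"

class complex_hilbert_space = complex_inner_space + complete_space

text \<open>
  Families indexed by a set \<open>I\<close> are functions, of which only the values on \<open>I\<close> matter. Sums are
  unordered; for the countable families considered here this is unconditional convergence.
\<close>

definition frame_with_bounds ::
    "real \<Rightarrow> real \<Rightarrow> 'i set \<Rightarrow> ('i \<Rightarrow> 'h::complex_hilbert_space) \<Rightarrow> bool" where
  "frame_with_bounds A B I \<phi> \<longleftrightarrow> 0 < A \<and> 0 < B \<and>
     (\<forall>f. (\<lambda>i. (cmod (cinner f (\<phi> i)))\<^sup>2) summable_on I \<and>
          A * (norm f)\<^sup>2 \<le> (\<Sum>\<^sub>\<infinity>i\<in>I. (cmod (cinner f (\<phi> i)))\<^sup>2) \<and>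
          (\<Sum>\<^sub>\<infinity>i\<in>I. (cmod (cinner f (\<phi> i)))\<^sup>2) \<le> B * (norm f)\<^sup>2)"

definition is_frame :: "'i set \<Rightarrow> ('i \<Rightarrow> 'h::complex_hilbert_space) \<Rightarrow> bool" where
  "is_frame I \<phi> \<longleftrightarrow> (\<exists>A B. frame_with_bounds A B I \<phi>)"

definition weaving :: "'i set \<Rightarrow> ('i \<Rightarrow> 'h) \<Rightarrow> ('i \<Rightarrow> 'h) \<Rightarrow> 'i \<Rightarrow> 'h" where
  "weaving \<sigma> \<phi> \<psi> i = (if i \<in> \<sigma> then \<phi> i else \<psi> i)"

definition woven ::
    "'i set \<Rightarrow> ('i \<Rightarrow> 'h::complex_hilbert_space) \<Rightarrow> ('i \<Rightarrow> 'h) \<Rightarrow> bool" where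
  "woven I \<phi> \<psi> \<longleftrightarrow> is_frame I \<phi> \<and> is_frame I \<psi> \<and>
     (\<exists>A B. 0 < A \<and> 0 < B \<and> (\<forall>\<sigma>\<subseteq>I. frame_with_bounds A B I (weaving \<sigma> \<phi> \<psi>)))"

text \<open>
  The two summability conditions only spell out that the series in the reconstruction formula
  converge, because \<^const>\<open>infsum\<close> is \<open>0\<close> on families that are not summable.
\<close>

definition alternate_dual_of_weaving ::
    "'i set \<Rightarrow> 'i set \<Rightarrow> ('i \<Rightarrow> 'h::complex_hilbert_space) \<Rightarrow> ('i \<Rightarrow> 'h) \<Rightarrow> ('i \<Rightarrow> 'h) \<Rightarrow> bool" where
  "alternate_dual_of_weaving I \<sigma> \<phi> \<psi> \<theta> \<longleftrightarrow> is_frame I \<theta> \<and>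
     (\<forall>f. (\<lambda>i. cinner f (\<phi> i) *\<^sub>C \<theta> i) summable_on \<sigma> \<and>
          (\<lambda>i. cinner f (\<psi> i) *\<^sub>C \<theta> i) summable_on (I - \<sigma>) \<and>
          f = (\<Sum>\<^sub>\<infinity>i\<in>\<sigma>. cinner f (\<phi> i) *\<^sub>C \<theta> i) + (\<Sum>\<^sub>\<infinity>i\<in>I - \<sigma>. cinner f (\<psi> i) *\<^sub>C \<theta> i))"

end

theory Submission
  imports Defs
begin

text \<open>
  Put \<open>u = (\<Sum>i\<in>\<sigma>. \<langle>f, \<theta>\<^sub>i\<rangle> \<phi>\<^sub>i)\<close> and \<open>v = (\<Sum>i\<in>\<sigma>\<^sup>c. \<langle>f, \<theta>\<^sub>i\<rangle> \<psi>\<^sub>i)\<close>; these converge because the analysis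
  coefficients of \<open>f\<close> are square summable and frames are Bessel families. Pairing the reconstruction
  formula for an arbitrary \<open>g\<close> with \<open>f\<close> gives \<open>u + v = f\<close>, and the claim becomes
  \<open>\<langle>u, f\<rangle> + \<parallel>v\<parallel>\<^sup>2 = \<langle>f, v\<rangle> + \<parallel>u\<parallel>\<^sup>2\<close>: both sides equal \<open>\<parallel>u\<parallel>\<^sup>2 + \<langle>u, v\<rangle> + \<parallel>v\<parallel>\<^sup>2\<close>.
\<close>

lemma cinner_add_right: "cinner x (y + z) = cinner x y + cinner x z"
  for x :: "'h::complex_inner_space"
  by (metis cinner_add_left cinner_commute complex_cnj_add)

lemma cinner_scaleC_right: "cinner x (a *\<^sub>C y) = cnj a * cinner x y"
  for x :: "'h::complex_inner_space"
  by (metis cinner_commute cinner_scaleC_left complex_cnj_mult)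

lemma cinner_scaleR_left: "cinner (r *\<^sub>R x) y = r *\<^sub>R cinner x y"
  for x :: "'h::complex_inner_space"
  by (metis cinner_scaleC_left scaleC_of_real scaleR_conv_of_real)

lemma cinner_zero_left [simp]: "cinner 0 y = 0"
  for y :: "'h::complex_inner_space"
  by (metis add_cancel_right_right cinner_add_left)

lemma cinner_sum_left: "cinner (\<Sum>i\<in>A. x i) y = (\<Sum>i\<in>A. cinner (x i) y)"
  for y :: "'h::complex_inner_space"
  by (induction A rule: infinite_finite_induct) (simp_all add: cinner_add_left)

lemma cinner_self: "cinner x x = complex_of_real ((norm x)\<^sup>2)"
  for x :: "'h::complex_inner_space"
proof -
  have "Im (cinner x x) = 0"
    using arg_cong[OF cinner_commute[of x x], of Im] by simp
  then show ?thesis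
    by (simp add: complex_eq_iff norm_eq_sqrt_cinner cinner_ge_zero)
qed

text \<open>The difference \<open>x - y\<close> is orthogonal to every \<open>z\<close>, in
  particular to itself. This lets a vector identity be proved by pairing with arbitrary test
  vectors.\<close>

lemma cinner_eqI:
  fixes x y :: "'h::complex_inner_space"
  assumes "\<And>z. cinner z x = cinner z y"
  shows "x = y"
proof -
  have "cinner z (x - y) = 0" for z
    using assms[of z] cinner_add_right[of z "x - y" y] by simp
  then show ?thesis
    using cinner_eq_zero_iff[of "x - y"] by simp
qed

lemma cmod_cinner_le: "cmod (cinner x y) \<le> norm x * norm y"
  for x :: "'h::complex_inner_space"
proof (cases "y = 0")
  case True
  then show ?thesis
    by (metis cinner_commute cinner_zero_left complex_cnj_zero mult_zero_right norm_zero order_refl)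
next
  case False
  \<comment> \<open>The vector \<open>b *\<^sub>C x + a *\<^sub>C y\<close> is the component of
    \<open>x\<close> orthogonal to \<open>y\<close>, scaled by \<open>(norm y)\<^sup>2\<close> so
    that no division occurs. Nonnegativity of its square norm is the Cauchy-Schwarz inequality, up
    to the positive factor \<open>(norm y)\<^sup>2\<close>.\<close>
  define c where "c = cinner x y"
  define a where "a = - c"
  define b where "b = complex_of_real ((norm y)\<^sup>2)"
  have "cinner (b *\<^sub>C x + a *\<^sub>C y) (b *\<^sub>C x + a *\<^sub>C y)
      = b * (b * complex_of_real ((norm x)\<^sup>2) - c * cnj c)"
    using cinner_commute[of y x]
    by (simp add: cinner_add_left cinner_add_right cinner_scaleC_left cinner_scaleC_right
        cinner_self[of x] cinner_self[of y] a_def c_def[symmetric] algebra_simps b_def)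
  also have "\<dots> = complex_of_real ((norm y)\<^sup>2 * ((norm y)\<^sup>2 * (norm x)\<^sup>2 - (cmod c)\<^sup>2))"
    by (simp add: b_def complex_norm_square[symmetric])
  finally have "0 \<le> (norm y)\<^sup>2 * ((norm y)\<^sup>2 * (norm x)\<^sup>2 - (cmod c)\<^sup>2)"
    using cinner_ge_zero by (metis Re_complex_of_real)
  then have "(cmod c)\<^sup>2 \<le> (norm x * norm y)\<^sup>2"
    using False by (simp add: zero_le_mult_iff power_mult_distrib mult.commute)
  then show ?thesis
    unfolding c_def by (rule power2_le_imp_le) simp
qed

lemma bounded_linear_cinner_left: "bounded_linear (\<lambda>x. cinner x y)"
  for y :: "'h::complex_inner_space"
  by (rule bounded_linear_intro[of _ "norm y"])
     (auto simp: cinner_add_left cinner_scaleR_left cmod_cinner_le)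

text \<open>Cauchy criterion for unordered sums. Any two finite sets containing \<open>F\<close>
  have sums within e/2 of \<open>sum f F\<close>, hence within e of each other, so the finite
  partial sums form a Cauchy filter, which converges by completeness.\<close>

lemma summable_on_small_tails:
  fixes f :: "'i \<Rightarrow> 'a::{real_normed_vector, complete_space}"
  assumes tails: "\<And>e. e > 0 \<Longrightarrow>
    \<exists>F. finite F \<and> F \<subseteq> A \<and> (\<forall>G. finite G \<longrightarrow> G \<subseteq> A - F \<longrightarrow> norm (sum f G) < e)"
  shows "f summable_on A"
proof -
  have "\<exists>P. eventually P (finite_subsets_at_top A) \<and>
      (\<forall>F F'. P F \<and> P F' \<longrightarrow> dist (sum f F) (sum f F') < e)" if "e > 0" for e
  proof -
    obtain F where F: "finite F" "F \<subseteq> A"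
      and small: "\<And>G. finite G \<Longrightarrow> G \<subseteq> A - F \<Longrightarrow> norm (sum f G) < e / 2"
      using tails[of "e / 2"] \<open>e > 0\<close> by auto
    define P where "P = (\<lambda>H. finite H \<and> F \<subseteq> H \<and> H \<subseteq> A)"
    have near: "dist (sum f H) (sum f F) < e / 2" if "P H" for H
    proof -
      have "norm (sum f (H - F)) < e / 2"
        using that by (intro small) (auto simp: P_def)
      moreover have "sum f (H - F) = sum f H - sum f F"
        using that by (simp add: P_def sum_diff)
      ultimately show ?thesis
        by (simp add: dist_norm)
    qed
    have "eventually P (finite_subsets_at_top A)"
      unfolding P_def eventually_finite_subsets_at_top using F by blast
    moreover have "\<forall>H H'. P H \<and> P H' \<longrightarrow> dist (sum f H) (sum f H') < e"
      by (intro allI impI, elim conjE) (rule dist_triangle_half_l[OF near near])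
    ultimately show ?thesis
      by blast
  qed
  then have "cauchy_filter (filtermap (sum f) (finite_subsets_at_top A))"
    by (simp add: cauchy_filter_metric_filtermap)
  moreover have "complete (UNIV :: 'a set)"
    by (meson Cauchy_convergent UNIV_I complete_def convergent_def)
  ultimately obtain L where "(sum f \<longlongrightarrow> L) (finite_subsets_at_top A)"
    using complete_uniform[where S = "UNIV :: 'a set"] by (force simp: filterlim_def)
  then show ?thesis
    by (auto simp: summable_on_def has_sum_def)
qed

text \<open>Choose \<open>F\<close> whose sum is within e/2 of the total. With nonnegative terms,
  adjoining a disjoint finite set cannot push the sum above the total, so that set contributes at
  most e/2.\<close>

lemma summable_on_nonneg_tail:
  fixes g :: "'i \<Rightarrow> real"
  assumes "g summable_on A" and "\<And>i. i \<in> A \<Longrightarrow> 0 \<le> g i" and "e > 0"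
  obtains F where "finite F" "F \<subseteq> A" "\<And>G. finite G \<Longrightarrow> G \<subseteq> A - F \<Longrightarrow> sum g G < e"
proof -
  obtain F where F: "finite F" "F \<subseteq> A" "dist (sum g F) (infsum g A) \<le> e / 2"
    using has_sum_finite_approximation[OF has_sum_infsum[OF assms(1)], of "e / 2"] \<open>e > 0\<close> by auto
  have "sum g G < e" if G: "finite G" "G \<subseteq> A - F" for G
  proof -
    have "sum g F + sum g G = sum g (F \<union> G)"
      using F G by (subst sum.union_disjoint) auto
    also have "\<dots> \<le> infsum g A"
      by (rule finite_sum_le_infsum) (use F G assms in auto)
    finally show ?thesis
      using F(3) \<open>e > 0\<close> unfolding dist_real_def by linarith
  qed
  with F that show ?thesis by blast
qed

lemma is_frame_bessel:
  assumes "is_frame I x"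
  obtains B where "B > 0"
    "\<And>f F. finite F \<Longrightarrow> F \<subseteq> I \<Longrightarrow> (\<Sum>i\<in>F. (cmod (cinner f (x i)))\<^sup>2) \<le> B * (norm f)\<^sup>2"
proof -
  obtain B where "B > 0" and summable: "\<And>f. (\<lambda>i. (cmod (cinner f (x i)))\<^sup>2) summable_on I"
    and upper: "\<And>f. (\<Sum>\<^sub>\<infinity>i\<in>I. (cmod (cinner f (x i)))\<^sup>2) \<le> B * (norm f)\<^sup>2"
    using assms unfolding is_frame_def frame_with_bounds_def by blast
  have "(\<Sum>i\<in>F. (cmod (cinner f (x i)))\<^sup>2) \<le> B * (norm f)\<^sup>2" if "finite F" "F \<subseteq> I" for f F
  proof -
    have "(\<Sum>i\<in>F. (cmod (cinner f (x i)))\<^sup>2) \<le> (\<Sum>\<^sub>\<infinity>i\<in>I. (cmod (cinner f (x i)))\<^sup>2)"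
      by (rule finite_sum_le_infsum[OF summable that]) simp
    also have "\<dots> \<le> B * (norm f)\<^sup>2"
      by (rule upper)
    finally show ?thesis .
  qed
  with \<open>B > 0\<close> that show thesis
    by blast
qed

text \<open>Synthesis is adjoint to analysis, so it inherits the Bessel bound. Expanding one slot of
  the inner product of the sum \<open>s\<close> with itself gives a scalar sum; Cauchy-Schwarz
  separates the coefficients from the numbers \<open>cinner s (x i)\<close>, and the Bessel bound is
  applied at \<open>s\<close> itself.\<close>

lemma norm_synthesis_le:
  fixes x :: "'i \<Rightarrow> 'h::complex_inner_space"
  assumes "B \<ge> 0"
    and bessel: "\<And>f. (\<Sum>i\<in>F. (cmod (cinner f (x i)))\<^sup>2) \<le> B * (norm f)\<^sup>2"
  shows "(norm (\<Sum>i\<in>F. c i *\<^sub>C x i))\<^sup>2 \<le> B * (\<Sum>i\<in>F. (cmod (c i))\<^sup>2)"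
proof -
  define s where "s = (\<Sum>i\<in>F. c i *\<^sub>C x i)"
  have "complex_of_real ((norm s)\<^sup>2) = (\<Sum>i\<in>F. c i * cinner (x i) s)"
    unfolding cinner_self[symmetric] by (subst s_def) (simp add: cinner_sum_left cinner_scaleC_left)
  then have "(norm s)\<^sup>2 = cmod (\<Sum>i\<in>F. c i * cinner (x i) s)"
    by (metis abs_of_nonneg norm_of_real zero_le_power2)
  also have "\<dots> \<le> (\<Sum>i\<in>F. cmod (c i) * cmod (cinner s (x i)))"
    by (rule sum_norm_le) (metis cinner_commute complex_mod_cnj norm_mult order_refl)
  finally have "((norm s)\<^sup>2)\<^sup>2 \<le> (\<Sum>i\<in>F. cmod (c i) * cmod (cinner s (x i)))\<^sup>2"
    by (rule power_mono) simp
  also have "\<dots> \<le> (\<Sum>i\<in>F. (cmod (c i))\<^sup>2) * (\<Sum>i\<in>F. (cmod (cinner s (x i)))\<^sup>2)"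
    by (rule Cauchy_Schwarz_ineq_sum)
  also have "\<dots> \<le> (\<Sum>i\<in>F. (cmod (c i))\<^sup>2) * (B * (norm s)\<^sup>2)"
    by (intro mult_left_mono bessel sum_nonneg) simp
  finally have le: "(norm s)\<^sup>2 * (norm s)\<^sup>2 \<le> (B * (\<Sum>i\<in>F. (cmod (c i))\<^sup>2)) * (norm s)\<^sup>2"
    by (simp add: power2_eq_square mult_ac)
  show ?thesis
  \<comment> \<open>Cancelling the common factor \<open>(norm s)\<^sup>2\<close> in
    \<open>le\<close> needs s nonzero; for s = 0 the right-hand side is nonnegative anyway.\<close>
  proof (cases "s = 0")
    case False
    then have "(norm s)\<^sup>2 \<le> B * (\<Sum>i\<in>F. (cmod (c i))\<^sup>2)"
      by (intro mult_right_le_imp_le[OF le]) simp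
    then show ?thesis
      unfolding s_def .
  next
    case True
    then show ?thesis
      unfolding s_def[symmetric] using \<open>B \<ge> 0\<close> by (simp add: sum_nonneg)
  qed
qed

lemma frame_synthesis_summable:
  fixes x :: "'i \<Rightarrow> 'h::complex_hilbert_space"
  assumes "is_frame I x" "J \<subseteq> I" and c: "(\<lambda>i. (cmod (c i))\<^sup>2) summable_on J"
  shows "(\<lambda>i. c i *\<^sub>C x i) summable_on J"
proof (rule summable_on_small_tails)
  fix e :: real assume "e > 0"
  obtain B where "B > 0" and bessel:
    "\<And>f F. finite F \<Longrightarrow> F \<subseteq> I \<Longrightarrow> (\<Sum>i\<in>F. (cmod (cinner f (x i)))\<^sup>2) \<le> B * (norm f)\<^sup>2"
    using is_frame_bessel[OF assms(1)] by blast
  \<comment> \<open>The threshold \<open>e\<^sup>2 / B\<close> is what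
    \<open>norm_synthesis_le\<close> turns into a squared norm below \<open>e\<^sup>2\<close>:
    square-summable coefficients have small tails, hence so do their syntheses.\<close>
  obtain F where F: "finite F" "F \<subseteq> J"
    and small: "\<And>G. finite G \<Longrightarrow> G \<subseteq> J - F \<Longrightarrow> (\<Sum>i\<in>G. (cmod (c i))\<^sup>2) < e\<^sup>2 / B"
    using summable_on_nonneg_tail[OF c, of "e\<^sup>2 / B"] \<open>B > 0\<close> \<open>e > 0\<close> by auto
  have "norm (\<Sum>i\<in>G. c i *\<^sub>C x i) < e" if G: "finite G" "G \<subseteq> J - F" for G
  proof -
    have "(norm (\<Sum>i\<in>G. c i *\<^sub>C x i))\<^sup>2 \<le> B * (\<Sum>i\<in>G. (cmod (c i))\<^sup>2)"
      by (intro norm_synthesis_le bessel) (use G assms(2) \<open>B > 0\<close> in auto)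
    also have "\<dots> < e\<^sup>2"
      using small[OF G] \<open>B > 0\<close> by (simp add: field_simps)
    finally show ?thesis
      using \<open>e > 0\<close> by (simp add: power2_less_imp_less)
  qed
  with F show "\<exists>F. finite F \<and> F \<subseteq> J \<and>
      (\<forall>G. finite G \<longrightarrow> G \<subseteq> J - F \<longrightarrow> norm (\<Sum>i\<in>G. c i *\<^sub>C x i) < e)"
    by blast
qed

lemma frame_coefficients_summable:
  assumes "is_frame I \<theta>" "J \<subseteq> I"
  shows "(\<lambda>i. (cmod (cinner f (\<theta> i)))\<^sup>2) summable_on J"
  using assms summable_on_subset_banach unfolding is_frame_def frame_with_bounds_def by blast

text \<open>Pairing with a fixed \<open>g\<close> is bounded and linear, so it passes through the
  unordered sum; vector series thereby become scalar series.\<close>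

lemma has_sum_cinner_synthesis:
  fixes x :: "'i \<Rightarrow> 'h::complex_inner_space"
  assumes "(\<lambda>i. c i *\<^sub>C x i) summable_on J"
  shows "((\<lambda>i. c i * cinner (x i) g) has_sum cinner (\<Sum>\<^sub>\<infinity>i\<in>J. c i *\<^sub>C x i) g) J"
  using has_sum_bounded_linear[OF bounded_linear_cinner_left has_sum_infsum[OF assms]]
  by (simp add: cinner_scaleC_left)

theorem theorem11:
  fixes \<phi> \<psi> \<theta> :: "'i \<Rightarrow> 'h::complex_hilbert_space"
    and I \<sigma> :: "'i set"
  assumes "separable_space (euclidean :: 'h topology)"
    and "countable I"
    and "woven I \<phi> \<psi>"
    and "\<sigma> \<subseteq> I"
    and "alternate_dual_of_weaving I \<sigma> \<phi> \<psi> \<theta>"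
  shows "\<forall>f.
    (\<lambda>i. cinner f (\<theta> i) * cnj (cinner f (\<phi> i))) summable_on \<sigma> \<and>
    (\<lambda>i. cinner f (\<theta> i) *\<^sub>C \<psi> i) summable_on (I - \<sigma>) \<and>
    (\<lambda>i. cinner f (\<theta> i) * cnj (cinner f (\<psi> i))) summable_on (I - \<sigma>) \<and>
    (\<lambda>i. cinner f (\<theta> i) *\<^sub>C \<phi> i) summable_on \<sigma> \<and>
    (\<Sum>\<^sub>\<infinity>i\<in>\<sigma>. cinner f (\<theta> i) * cnj (cinner f (\<phi> i)))
      + complex_of_real ((norm (\<Sum>\<^sub>\<infinity>i\<in>I - \<sigma>. cinner f (\<theta> i) *\<^sub>C \<psi> i))\<^sup>2)
    = cnj (\<Sum>\<^sub>\<infinity>i\<in>I - \<sigma>. cinner f (\<theta> i) * cnj (cinner f (\<psi> i)))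
      + complex_of_real ((norm (\<Sum>\<^sub>\<infinity>i\<in>\<sigma>. cinner f (\<theta> i) *\<^sub>C \<phi> i))\<^sup>2)"
proof
  fix f
  have frames: "is_frame I \<phi>" "is_frame I \<psi>" "is_frame I \<theta>"
    using assms(3,5) unfolding woven_def alternate_dual_of_weaving_def by blast+
  define u where "u = (\<Sum>\<^sub>\<infinity>i\<in>\<sigma>. cinner f (\<theta> i) *\<^sub>C \<phi> i)"
  define v where "v = (\<Sum>\<^sub>\<infinity>i\<in>I - \<sigma>. cinner f (\<theta> i) *\<^sub>C \<psi> i)"
  have su: "(\<lambda>i. cinner f (\<theta> i) *\<^sub>C \<phi> i) summable_on \<sigma>"
    by (intro frame_synthesis_summable[OF frames(1)] frame_coefficients_summable[OF frames(3)] assms)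
  have sv: "(\<lambda>i. cinner f (\<theta> i) *\<^sub>C \<psi> i) summable_on (I - \<sigma>)"
    by (intro frame_synthesis_summable[OF frames(2)] frame_coefficients_summable[OF frames(3)]) auto
  \<comment> \<open>The test vector \<open>g\<close> stays arbitrary: general \<open>g\<close>
    serves to identify \<open>u + v\<close> with \<open>f\<close>, while \<open>g = f\<close> gives
    the two scalar series of the claim.\<close>
  have hu: "((\<lambda>i. cinner f (\<theta> i) * cnj (cinner g (\<phi> i))) has_sum cinner u g) \<sigma>" for g
    using has_sum_cinner_synthesis[OF su, of g]
    by (simp add: u_def cinner_commute[symmetric])
  have hv: "((\<lambda>i. cinner f (\<theta> i) * cnj (cinner g (\<psi> i))) has_sum cinner v g) (I - \<sigma>)" for g
    using has_sum_cinner_synthesis[OF sv, of g]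
    by (simp add: v_def cinner_commute[symmetric])
  have "cinner g f = cinner g (u + v)" for g
  proof -
    have sg: "(\<lambda>i. cinner g (\<phi> i) *\<^sub>C \<theta> i) summable_on \<sigma>"
        "(\<lambda>i. cinner g (\<psi> i) *\<^sub>C \<theta> i) summable_on (I - \<sigma>)"
      and g: "g = (\<Sum>\<^sub>\<infinity>i\<in>\<sigma>. cinner g (\<phi> i) *\<^sub>C \<theta> i) + (\<Sum>\<^sub>\<infinity>i\<in>I - \<sigma>. cinner g (\<psi> i) *\<^sub>C \<theta> i)"
      using assms(5) unfolding alternate_dual_of_weaving_def by blast+
    \<comment> \<open>Conjugating \<open>hu\<close> termwise yields exactly the series obtained by
      pairing the \<sigma>-part of the reconstruction of \<open>g\<close> with \<open>f\<close>, so
      uniqueness of sums identifies the two values. The complementary part is handled alike.\<close>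
    have "((\<lambda>i. cinner g (\<phi> i) * cinner (\<theta> i) f) has_sum cinner g u) \<sigma>"
      using has_sum_cnj_iff[THEN iffD2, OF hu[of g]] by (simp add: mult.commute cinner_commute[symmetric])
    then have a: "cinner (\<Sum>\<^sub>\<infinity>i\<in>\<sigma>. cinner g (\<phi> i) *\<^sub>C \<theta> i) f = cinner g u"
      using has_sum_cinner_synthesis[OF sg(1), of f] has_sum_unique by blast
    have "((\<lambda>i. cinner g (\<psi> i) * cinner (\<theta> i) f) has_sum cinner g v) (I - \<sigma>)"
      using has_sum_cnj_iff[THEN iffD2, OF hv[of g]] by (simp add: mult.commute cinner_commute[symmetric])
    then have b: "cinner (\<Sum>\<^sub>\<infinity>i\<in>I - \<sigma>. cinner g (\<psi> i) *\<^sub>C \<theta> i) f = cinner g v"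
      using has_sum_cinner_synthesis[OF sg(2), of f] has_sum_unique by blast
    show ?thesis
      by (subst g) (simp only: cinner_add_left cinner_add_right a b)
  qed
  then have f: "f = u + v"
    by (rule cinner_eqI)
  have "cinner u f + complex_of_real ((norm v)\<^sup>2) = cnj (cinner v f) + complex_of_real ((norm u)\<^sup>2)"
    unfolding f cinner_self[symmetric]
    by (simp add: cinner_add_left cinner_add_right cinner_commute[symmetric])
  then show "(\<lambda>i. cinner f (\<theta> i) * cnj (cinner f (\<phi> i))) summable_on \<sigma> \<and>
    (\<lambda>i. cinner f (\<theta> i) *\<^sub>C \<psi> i) summable_on (I - \<sigma>) \<and>
    (\<lambda>i. cinner f (\<theta> i) * cnj (cinner f (\<psi> i))) summable_on (I - \<sigma>) \<and>
    (\<lambda>i. cinner f (\<theta> i) *\<^sub>C \<phi> i) summable_on \<sigma> \<and>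
    (\<Sum>\<^sub>\<infinity>i\<in>\<sigma>. cinner f (\<theta> i) * cnj (cinner f (\<phi> i)))
      + complex_of_real ((norm (\<Sum>\<^sub>\<infinity>i\<in>I - \<sigma>. cinner f (\<theta> i) *\<^sub>C \<psi> i))\<^sup>2)
    = cnj (\<Sum>\<^sub>\<infinity>i\<in>I - \<sigma>. cinner f (\<theta> i) * cnj (cinner f (\<psi> i)))
      + complex_of_real ((norm (\<Sum>\<^sub>\<infinity>i\<in>\<sigma>. cinner f (\<theta> i) *\<^sub>C \<phi> i))\<^sup>2)"
    using su sv has_sum_imp_summable[OF hu] has_sum_imp_summable[OF hv]
    unfolding infsumI[OF hu] infsumI[OF hv] u_def[symmetric] v_def[symmetric]
    by blast
qed

end
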